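(* Let $\boldsymbol{z}^{p1},\boldsymbol{z}^{p2}$ be two Pareto (nondominated) points of the bi-objective problem with $z^{p1}_1<z^{p2}_1$, let $F_S^p$ be the facet (line segment) with endpoints $\boldsymbol{z}^{p1},\boldsymbol{z}^{p2}$, let $\boldsymbol{\bar n}^k$ be its outer unit normal vector, let $\boldsymbol{\Phi}^k\boldsymbol{\beta}^k$ be the associated reference point, and let $\epsilon_z>0$. Let (mNBI), (mNBI-a) and (mNBI-b) be the subproblems defined in the context for these parameters. (a) Suppose that the solution of (mNBI) lies at $\boldsymbol{z}^{p1}$, i.e. (mNBI) has an optimal solution $(\boldsymbol{x},t)$ with $\boldsymbol{f}(\boldsymbol{x})=\boldsymbol{z}^{p1}$. If $(\boldsymbol{x}^*,\boldsymbol{z}^*,t^* )$ is a solution of (mNBI-a) (that is, $(\boldsymbol{x}^*,t^* )$ is optimal for (mNBI-a) and $\boldsymbol{z}^*=\boldsymbol{f}(\boldsymbol{x}^* )$) and $\boldsymbol{z}^*$ is a nondominated point, then there is no nondominated point $\boldsymbol{z}=(z_1,z_2)^\top$ such that $z^{p1}_1+\epsilon_z<z_1<z^*_1$. (b) Suppose that the solution of (mNBI) lies at $\boldsymbol{z}^{p2}$, i.e. (mNBI) has an optimal solution $(\boldsymbol{x},t)$ with $\boldsymbol{f}(\boldsymbol{x})=\boldsymbol{z}^{p2}$. If $(\boldsymbol{x}^*,\boldsymbol{z}^*,t^* )$ is a solution of (mNBI-b) (that is, $(\boldsymbol{x}^*,t^* )$ is optimal for (mNBI-b) and $\boldsymbol{z}^*=\boldsymbol{f}(\boldsymbol{x}^*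 )$) and $\boldsymbol{z}^*$ is a nondominated point, then there is no nondominated point $\boldsymbol{z}=(z_1,z_2)^\top$ such that $z^*_1<z_1<z^{p2}_1-\epsilon_z$.
   Context: Bi-objective problem: minimize $\boldsymbol{f}(\boldsymbol{x})=(f_1(\boldsymbol{x}),f_2(\boldsymbol{x}))^\top$ over a nonempty feasible set $X=\{\boldsymbol{x}\in\mathbb{R}^{n_1}\times\mathbb{N}^{n_2} \mid \boldsymbol{g}(\boldsymbol{x})\le\boldsymbol{0},\ \boldsymbol{h}(\boldsymbol{x})=\boldsymbol{0}\}$, where $f_1,f_2$ are real-valued and bounded above and below; no convexity is assumed. All vector inequalities are component-wise. A point $\boldsymbol{x}^*\in X$ is efficient (Pareto-optimal) if there is no $\boldsymbol{x}\in X$ with $f_j(\boldsymbol{x})\le f_j(\boldsymbol{x}^* )$ for $j=1,2$ and $f_{j'}(\boldsymbol{x})<f_{j'}(\boldsymbol{x}^* )$ for at least one $j'\in\{1,2\}$. A nondominated point (Pareto point) is a vector $\boldsymbol{z}=\boldsymbol{f}(\boldsymbol{x}^* )\in\mathbb{R}^2$ with $\boldsymbol{x}^*$ efficient. The ideal vector $\boldsymbol{f}^{id}\in\mathbb{R}^2$ has components $f^{id}_j=\min f_j(\boldsymbol{x})$, the minimum being taken over all efficient $\boldsymbol{x}$. Parameters attached to the facet $F_S^p$ with endpoints $\boldsymbol{z}^{p1},\boldsymbol{z}^{p2}$, $z^{p1}_1<z^{p2}_1$ (hence $z^{p1}_2>z^{p2}_2$, both points being nondominated): - $\boldsymbol{\Phi}^k$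 is the $2\times2$ matrix whose $i$-th column is $\boldsymbol{z}^{pi}-\boldsymbol{z}^o$, with $\boldsymbol{z}^o=(z^{p1}_1,z^{p2}_2)^\top$. - $\boldsymbol{\beta}^k=(\beta^k_1,1-\beta^k_1)^\top\in\mathbb{R}^2_+$ is a fixed vector of convex weights (the algorithm uses $\beta^k_1=1/2$). - $\boldsymbol{\bar n}^k\in\mathbb{R}^2$ is the unit normal vector to the segment $F_S^p$ pointing outward, i.e. the one with both components negative. Subproblems: (mNBI): maximize $t$ over $\boldsymbol{x}\in X$, $t\in\mathbb{R}$, subject to $\boldsymbol{\Phi}^k\boldsymbol{\beta}^k+t\,\boldsymbol{\bar n}^k\ge\boldsymbol{f}(\boldsymbol{x})-\boldsymbol{f}^{id}$. (mNBI-a): maximize $t$ over $\boldsymbol{x}\in X$, $t\in\mathbb{R}$, subject to $\boldsymbol{\Phi}^k\boldsymbol{\beta}^k+t\,\boldsymbol{\bar n}^k\ge\boldsymbol{f}(\boldsymbol{x})-\boldsymbol{f}^{id}$ and $f_1(\boldsymbol{x})\ge z^{p1}_1+\epsilon_z$. (mNBI-b): maximize $t$ over $\boldsymbol{x}\in X$, $t\in\mathbb{R}$, subject to $\boldsymbol{\Phi}^k\boldsymbol{\beta}^k+t\,\boldsymbol{\bar n}^k\ge\boldsymbol{f}(\boldsymbol{x})-\boldsymbol{f}^{id}$ and $f_1(\boldsymbol{x})\le z^{p2}_1-\epsilon_z$. *)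

theory Defs
  imports "HOL-Analysis.Analysis"
begin

text \<open>
  Points of \<open>\<real>\<^bsup>n1\<^esup> \<times> \<nat>\<^bsup>n2\<^esup>\<close> are pairs of extensional functions on \<open>{..<n1}\<close> and \<open>{..<n2}\<close>;
  natural-number dimensions are used, rather than finite index types, so that the purely
  continuous and purely integer cases (\<open>n2 = 0\<close>, \<open>n1 = 0\<close>) and problems without inequality
  or equality constraints are included.
\<close>

type_synonym mixed_point = "(nat \<Rightarrow> real) \<times> (nat \<Rightarrow> nat)"

definition mixed_space :: "nat \<Rightarrow> nat \<Rightarrow> mixed_point set" where
  "mixed_space n1 n2 = ({..<n1} \<rightarrow>\<^sub>E UNIV) \<times> ({..<n2} \<rightarrow>\<^sub>E UNIV)"

definition feasible_set ::
  "nat \<Rightarrow> nat \<Rightarrow> nat \<Rightarrow> (mixed_point \<Rightarrow> nat \<Rightarrow> real) \<Rightarrow> nat \<Rightarrow> (mixed_point \<Rightarrow> nat \<Rightarrow> real)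
    \<Rightarrow> mixed_point set" where
  "feasible_set n1 n2 m g q h =
     {x \<in> mixed_space n1 n2. (\<forall>i<m. g x i \<le> 0) \<and> (\<forall>i<q. h x i = 0)}"

definition efficient :: "'x set \<Rightarrow> ('x \<Rightarrow> real^2) \<Rightarrow> 'x \<Rightarrow> bool" where
  "efficient X f xs \<longleftrightarrow> xs \<in> X \<and>
     \<not> (\<exists>x\<in>X. (\<forall>j. f x $ j \<le> f xs $ j) \<and> (\<exists>j. f x $ j < f xs $ j))"

definition nondominated :: "'x set \<Rightarrow> ('x \<Rightarrow> real^2) \<Rightarrow> real^2 \<Rightarrow> bool" where
  "nondominated X f z \<longleftrightarrow> (\<exists>x. efficient X f x \<and> z = f x)"

text \<open>
  The ideal vector is a minimum, not an infimum: each component is attained at an efficient point.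
\<close>

definition is_ideal_vector :: "'x set \<Rightarrow> ('x \<Rightarrow> real^2) \<Rightarrow> real^2 \<Rightarrow> bool" where
  "is_ideal_vector X f v \<longleftrightarrow>
     (\<forall>j. (\<exists>x. efficient X f x \<and> f x $ j = v $ j) \<and> (\<forall>x. efficient X f x \<longrightarrow> v $ j \<le> f x $ j))"

definition facet_origin :: "real^2 \<Rightarrow> real^2 \<Rightarrow> real^2" where
  "facet_origin zp1 zp2 = vector [zp1 $ 1, zp2 $ 2]"

definition Phi :: "real^2 \<Rightarrow> real^2 \<Rightarrow> real^2^2" where
  "Phi zp1 zp2 = (\<chi> i j. ((if j = 1 then zp1 else zp2) - facet_origin zp1 zp2) $ i)"

definition convex_weights :: "real^2 \<Rightarrow> bool" where
  "convex_weights \<beta> \<longleftrightarrow> 0 \<le> \<beta> $ 1 \<and> 0 \<le> \<beta> $ 2 \<and> \<beta> $ 2 = 1 - \<beta> $ 1"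

definition is_outer_unit_normal :: "(real^2) set \<Rightarrow> real^2 \<Rightarrow> bool" where
  "is_outer_unit_normal F n \<longleftrightarrow>
     norm n = 1 \<and> (\<forall>u\<in>F. \<forall>v\<in>F. n \<bullet> (u - v) = 0) \<and> (\<forall>j. n $ j < 0)"

text \<open>
  Feasible pairs \<open>(x, t)\<close> of the three subproblems for reference point \<open>r\<close>, normal \<open>n\<close> and
  ideal vector \<open>fid\<close>. The order on \<open>real^2\<close> is the component-wise one.
\<close>

definition mNBI :: "'x set \<Rightarrow> ('x \<Rightarrow> real^2) \<Rightarrow> real^2 \<Rightarrow> real^2 \<Rightarrow> real^2 \<Rightarrow> ('x \<times> real) set" where
  "mNBI X f fid r n = {(x, t). x \<in> X \<and> r + t *\<^sub>R n \<ge> f x - fid}"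

definition mNBI_a ::
  "'x set \<Rightarrow> ('x \<Rightarrow> real^2) \<Rightarrow> real^2 \<Rightarrow> real^2 \<Rightarrow> real^2 \<Rightarrow> real^2 \<Rightarrow> real \<Rightarrow> ('x \<times> real) set" where
  "mNBI_a X f fid r n zp1 \<epsilon> =
     {(x, t). x \<in> X \<and> r + t *\<^sub>R n \<ge> f x - fid \<and> f x $ 1 \<ge> zp1 $ 1 + \<epsilon>}"

definition mNBI_b ::
  "'x set \<Rightarrow> ('x \<Rightarrow> real^2) \<Rightarrow> real^2 \<Rightarrow> real^2 \<Rightarrow> real^2 \<Rightarrow> real^2 \<Rightarrow> real \<Rightarrow> ('x \<times> real) set" where
  "mNBI_b X f fid r n zp2 \<epsilon> =
     {(x, t). x \<in> X \<and> r + t *\<^sub>R n \<ge> f x - fid \<and> f x $ 1 \<le> zp2 $ 1 - \<epsilon>}"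

definition maximizes_t :: "('x \<times> real) set \<Rightarrow> 'x \<Rightarrow> real \<Rightarrow> bool" where
  "maximizes_t S x t \<longleftrightarrow> is_arg_max snd (\<lambda>p. p \<in> S) (x, t)"

end

theory Submission
  imports Defs
begin

text \<open>
  Since both components of the normal are negative, a pair \<open>(x, t)\<close> is feasible for mNBI iff \<open>f x\<close>
  lies in a quadrant whose corner moves down and to the left, in both coordinates at once, as \<open>t\<close>
  grows; the optimal \<open>t\<close> belongs to the smallest quadrant that still meets the admissible images.
  Let \<open>z\<^sup>0\<close> be the end point at which mNBI is optimal and \<open>z\<^sup>*\<close> the solution of the restricted
  problem. The restriction can only lower the optimal value, so \<open>z\<^sup>0\<close> and \<open>z\<^sup>*\<close> both lie in the
  quadrant of \<open>z\<^sup>*\<close>. On the Pareto front one coordinate increases exactly when the other one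
  decreases. A nondominated point \<open>z\<close> between \<open>z\<^sup>0\<close> and \<open>z\<^sup>*\<close> is therefore strictly below
  \<open>z\<^sup>*\<close> in one coordinate and strictly below \<open>z\<^sup>0\<close> in the other, hence in the interior of that
  quadrant, and the quadrant can be shrunk without losing \<open>z\<close>
  (\<open>mNBI_slack_improvable\<close>). If \<open>z\<close> satisfies the extra constraint, this contradicts the optimality
  of \<open>z\<^sup>*\<close> (\<open>no_mixed_improvement\<close>).

  The two end points differ only in which coordinate is beaten where: to the right of \<open>z\<^sup>p\<^sup>1\<close> the
  point \<open>z\<close> is below \<open>z\<^sup>*\<close> in the first coordinate and below \<open>z\<^sup>p\<^sup>1\<close> in the second; to the left of
  \<open>z\<^sup>p\<^sup>2\<close> it is below \<open>z\<^sup>p\<^sup>2\<close> in the first and below \<open>z\<^sup>*\<close> in the second.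
\<close>

lemma vec2_le_iff: "(u::real^2) \<le> v \<longleftrightarrow> (\<forall>j. u $ j \<le> v $ j)"
  by (simp add: less_eq_vec_def)

lemma maximizes_tD:
  assumes "maximizes_t S x t"
  shows "(x, t) \<in> S" and "\<And>y s. (y, s) \<in> S \<Longrightarrow> s \<le> t"
  using assms unfolding maximizes_t_def is_arg_max_def by force+

text \<open>
  On the Pareto front, moving to the right means moving strictly down: otherwise the point on the
  left would dominate the other one.
\<close>

lemma nondominated_trade_off:
  assumes "nondominated X f z" and "nondominated X f w" and "w $ 1 < z $ 1"
  shows "z $ 2 < w $ 2"
proof (rule ccontr)
  assume "\<not> z $ 2 < w $ 2"
  with assms(3) have "(\<forall>j. w $ j \<le> z $ j) \<and> (\<exists>j. w $ j < z $ j)"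
    by (auto simp: forall_2)
  with assms(1,2) show False
    unfolding nondominated_def efficient_def by blast
qed

text \<open>
  Slack in both coordinates can be traded for a larger \<open>t\<close>: the largest feasible value is the
  smaller of the two quotients of slack and speed of the corner.
\<close>

lemma mNBI_slack_improvable:
  fixes n :: "real^2"
  assumes "y \<in> X" and neg: "\<And>j. n $ j < 0"
    and slack: "\<And>j. f y $ j - fid $ j < r $ j + t * n $ j"
  obtains t' where "t < t'" and "(y, t') \<in> mNBI X f fid r n"
proof -
  define d where "d j = (f y $ j - fid $ j - r $ j) / n $ j" for j
  have above: "t < d j" for j
    using slack[of j] neg[of j] by (simp add: d_def field_simps)
  have "f y $ j - fid $ j \<le> r $ j + min (d 1) (d 2) * n $ j" for j
  proof -
    have "min (d 1) (d 2) \<le> d j"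
      using exhaust_2[of j] by auto
    then have "d j * n $ j \<le> min (d 1) (d 2) * n $ j"
      using neg[of j] by (intro mult_right_mono_neg) auto
    then show ?thesis
      using neg[of j] by (simp add: d_def)
  qed
  then have "(y, min (d 1) (d 2)) \<in> mNBI X f fid r n"
    using \<open>y \<in> X\<close> by (simp add: mNBI_def vec2_le_iff)
  with above show thesis
    by (intro that[of "min (d 1) (d 2)"]) auto
qed

text \<open>
  A point \<open>y\<close> that beats, in each coordinate, the global or the restricted optimum lies strictly
  inside the quadrant of the restricted optimum, because that quadrant contains both of them. The
  last hypothesis says that \<open>y\<close> satisfies the constraint that defines the restriction \<open>S\<close>.
\<close>

lemma no_mixed_improvement:
  fixes n :: "real^2"
  assumes neg: "\<And>j. n $ j < 0"
    and global: "maximizes_t (mNBI X f fid r n) x0 t0"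
    and restricted: "maximizes_t S xs ts" and sub: "S \<subseteq> mNBI X f fid r n"
    and "y \<in> X" and better: "\<And>j. f y $ j < f x0 $ j \<or> f y $ j < f xs $ j"
    and in_S: "\<And>t. (y, t) \<in> mNBI X f fid r n \<Longrightarrow> (y, t) \<in> S"
  shows False
proof -
  have xs: "(xs, ts) \<in> mNBI X f fid r n"
    using maximizes_tD(1)[OF restricted] sub by blast
  have "ts \<le> t0"
    using maximizes_tD(2)[OF global xs] .
  have "f y $ j - fid $ j < r $ j + ts * n $ j" for j
  proof -
    have "f xs $ j - fid $ j \<le> r $ j + ts * n $ j"
      using xs by (simp add: mNBI_def vec2_le_iff)
    moreover have "f x0 $ j - fid $ j \<le> r $ j + t0 * n $ j"
      using maximizes_tD(1)[OF global] by (simp add: mNBI_def vec2_le_iff)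
    moreover have "t0 * n $ j \<le> ts * n $ j"
      using \<open>ts \<le> t0\<close> neg[of j] by (intro mult_right_mono_neg) auto
    ultimately show ?thesis
      using better[of j] by linarith
  qed
  then obtain t' where "ts < t'" and "(y, t') \<in> mNBI X f fid r n"
    using mNBI_slack_improvable[OF \<open>y \<in> X\<close> neg] by blast
  with in_S maximizes_tD(2)[OF restricted] show False
    by fastforce
qed

theorem theorem4p2:
  fixes n1 n2 m q :: nat
    and g h :: "mixed_point \<Rightarrow> nat \<Rightarrow> real"
    and X :: "mixed_point set"
    and f :: "mixed_point \<Rightarrow> real^2"
    and fid zp1 zp2 \<beta> nbar r :: "real^2"
    and \<epsilon> :: real
  assumes X_def: "X = feasible_set n1 n2 m g q h"
    and X_nonempty: "X \<noteq> {}"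
    and f_bounded: "\<And>j. bdd_above ((\<lambda>x. f x $ j) ` X) \<and> bdd_below ((\<lambda>x. f x $ j) ` X)"
    and ideal: "is_ideal_vector X f fid"
    and zp1: "nondominated X f zp1"
    and zp2: "nondominated X f zp2"
    and zp1_less_zp2: "zp1 $ 1 < zp2 $ 1"
    and weights: "convex_weights \<beta>"
    and normal: "is_outer_unit_normal (closed_segment zp1 zp2) nbar"
    and ref_point: "r = Phi zp1 zp2 *v \<beta>"
    and eps_pos: "\<epsilon> > 0"
  shows "((\<exists>x t. maximizes_t (mNBI X f fid r nbar) x t \<and> f x = zp1) \<longrightarrow>
          (\<forall>xs zs ts. maximizes_t (mNBI_a X f fid r nbar zp1 \<epsilon>) xs ts \<and> zs = f xs
              \<and> nondominated X f zs \<longrightarrow>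
            \<not> (\<exists>z. nondominated X f z \<and> zp1 $ 1 + \<epsilon> < z $ 1 \<and> z $ 1 < zs $ 1)))
       \<and> ((\<exists>x t. maximizes_t (mNBI X f fid r nbar) x t \<and> f x = zp2) \<longrightarrow>
          (\<forall>xs zs ts. maximizes_t (mNBI_b X f fid r nbar zp2 \<epsilon>) xs ts \<and> zs = f xs
              \<and> nondominated X f zs \<longrightarrow>
            \<not> (\<exists>z. nondominated X f z \<and> zs $ 1 < z $ 1 \<and> z $ 1 < zp2 $ 1 - \<epsilon>)))"
proof (intro conjI impI allI notI; elim exE conjE)
  have neg: "\<And>j. nbar $ j < 0"
    using normal by (simp add: is_outer_unit_normal_def)
  {
    fix xs zs ts z x t
    assume x: "maximizes_t (mNBI X f fid r nbar) x t" "f x = zp1"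
      and xs: "maximizes_t (mNBI_a X f fid r nbar zp1 \<epsilon>) xs ts" "zs = f xs"
      and z: "nondominated X f z" "zp1 $ 1 + \<epsilon> < z $ 1" "z $ 1 < zs $ 1"
    obtain y where y: "y \<in> X" "z = f y"
      using z(1) by (auto simp: nondominated_def efficient_def)
    have "z $ 2 < zp1 $ 2"
      using nondominated_trade_off[OF z(1) zp1] z(2) eps_pos by simp
    then have better: "f y $ j < f x $ j \<or> f y $ j < f xs $ j" for j
      using exhaust_2[of j] x(2) xs(2) y(2) z(3) by auto
    show False
      by (rule no_mixed_improvement[OF neg x(1) xs(1) _ y(1) better])
        (use y z(2) in \<open>auto simp: mNBI_def mNBI_a_def\<close>)
  }
  {
    fix xs zs ts z x t
    assume x: "maximizes_t (mNBI X f fid r nbar) x t" "f x = zp2"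
      and xs: "maximizes_t (mNBI_b X f fid r nbar zp2 \<epsilon>) xs ts" "zs = f xs"
      and zs: "nondominated X f zs"
      and z: "nondominated X f z" "zs $ 1 < z $ 1" "z $ 1 < zp2 $ 1 - \<epsilon>"
    obtain y where y: "y \<in> X" "z = f y"
      using z(1) by (auto simp: nondominated_def efficient_def)
    have "z $ 2 < zs $ 2"
      using nondominated_trade_off[OF z(1) zs z(2)] .
    then have better: "f y $ j < f x $ j \<or> f y $ j < f xs $ j" for j
      using exhaust_2[of j] x(2) xs(2) y(2) z(3) eps_pos by auto
    show False
      by (rule no_mixed_improvement[OF neg x(1) xs(1) _ y(1) better])
        (use y z(3) in \<open>auto simp: mNBI_def mNBI_b_def\<close>)
  }
qed

end
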